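(* Let $\mathbb{F}$ be an arbitrary field, let $n$ be a positive integer, and let $A \in \mathrm{M}_n(\mathbb{F})$ be a square matrix with trace zero. Then the block-diagonal matrix $A\oplus 0_n \in \mathrm{M}_{2n}(\mathbb{F})$ is the sum of three square-zero matrices of $\mathrm{M}_{2n}(\mathbb{F})$.
   Context: $\mathrm{M}_n(\mathbb{F})$ denotes the algebra of all $n \times n$ matrices with entries in $\mathbb{F}$. A square matrix $S$ is called square-zero if $S^2=0$ (the zero matrix is allowed). $A \oplus 0_n$ denotes the block-diagonal matrix $\begin{bmatrix} A & 0 \\ 0 & 0_n\end{bmatrix}$, where $0_n$ is the $n\times n$ zero matrix. *)

theory Defs
  imports "Jordan_Normal_Form.Matrix"
begin

definition mat_trace :: "'a :: comm_monoid_add mat \<Rightarrow> 'a" where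
  "mat_trace A = (\<Sum>i<dim_row A. A $$ (i, i))"

definition square_zero :: "'a :: semiring_1 mat \<Rightarrow> bool" where
  "square_zero S \<longleftrightarrow> square_mat S \<and> S ^\<^sub>m 2 = 0\<^sub>m (dim_row S) (dim_row S)"

definition direct_sum_zero :: "'a :: zero mat \<Rightarrow> nat \<Rightarrow> 'a mat"  where
  "direct_sum_zero A m = four_block_mat A (0\<^sub>m (dim_row A) m) (0\<^sub>m m (dim_col A)) (0\<^sub>m m m)"

end

theory Submission
  imports Defs
begin

text \<open>The heart of the matter is that a matrix \<open>M\<close> of size \<open>2 n\<close> with diagonal blocks \<open>X * Y\<close> and
  \<open>- (Y * X)\<close> is always a sum of three square-zero matrices: one square-zero matrix has these
  diagonal blocks, and what is left is block antidiagonal, hence a sum of two more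
  (\<open>sum_of_three_square_zero_swapped_diagonal\<close>). It remains to find such an \<open>M\<close>
  similar to \<open>A \<oplus> 0\<close>. Conjugating \<open>A \<oplus> 0\<close> with block shears produces diagonal
  blocks \<open>A + G\<close> and \<open>- G * E\<close>, where \<open>E\<close> is a projection onto the column space of \<open>A\<close> and
  \<open>G\<close> is any matrix with columns in that space. If \<open>A\<close> is invertible, then \<open>E = 1\<close>, and all that is
  needed is \<open>A = X * Y - Y * X\<close>.

  For singular \<open>A\<close> one cannot expect \<open>X * Y - A\<close> to have its columns in the column
  space of \<open>A\<close>. The remedy is a full rank factorization \<open>A = P * Q\<close> with one-sided inverses of
  \<open>P\<close> and \<open>Q\<close> (\<open>full_rank_factorization\<close>): it suffices to write the smaller matrix \<open>Q * P\<close>,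
  which has the same trace as \<open>A\<close>, as a commutator
  (\<open>sum_of_three_square_zero_if_core_commutator\<close>).

  So what is needed is the theorem of Albert and Muckenhoupt that every matrix of trace zero is
  a commutator, for all fields, including the small ones (\<open>trace_zero_is_commutator\<close>). Its
  proof here rests on a normal form: every matrix is similar to one whose indices can be
  divided into two classes such that the first diagonal block is upper triangular and the second is
  strictly upper triangular (\<open>two_coloured_form\<close>). For a companion matrix this is the division
  into odd and even indices, the class of the last index being the first one, because an entry
  just below the diagonal links indices of different parity. If the trace is zero, then the normal form is a commutator with
  \<open>J \<oplus> (1 + J')\<close>, for nilpotent shift matrices \<open>J\<close> and \<open>J'\<close>
  (\<open>is_commutator_triangular_blocks\<close>): the diagonal blocks are handled by summing along
  diagonals, the off-diagonal ones by Sylvester equations, which are solvable because the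
  spectra \<open>{0}\<close> and \<open>{1}\<close> are disjoint.\<close>

section \<open>Matrix algebra with dimension side conditions\<close>

text \<open>These laws carry equations between dimensions instead of carrier memberships. Such side
  conditions mention no dimension that is absent from the term, so the simplifier can
  discharge them for products of rectangular matrices.\<close>

lemma mult_assoc_dim:
  fixes A B C :: "'a :: semiring_0 mat"
  assumes "dim_col A = dim_row B" "dim_col B = dim_row C"
  shows "A * B * C = A * (B * C)"
  using assms by (intro assoc_mult_mat[of _ "dim_row A" "dim_row B" _ "dim_row C" _ "dim_col C"]) auto

lemma distrib_left_dim:
  fixes A B C :: "'a :: ring mat"
  assumes "dim_col A = dim_row B" "dim_row C = dim_row B" "dim_col C = dim_col B"
  shows "A * (B + C) = A * B + A * C" "A * (B - C) = A * B - A * C"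
proof -
  have c: "A \<in> carrier_mat (dim_row A) (dim_row B)" "B \<in> carrier_mat (dim_row B) (dim_col B)"
    "C \<in> carrier_mat (dim_row B) (dim_col B)" using assms by auto
  show "A * (B + C) = A * B + A * C" by (rule mult_add_distrib_mat[OF c])
  show "A * (B - C) = A * B - A * C" by (rule mult_minus_distrib_mat[OF c])
qed

lemma distrib_right_dim:
  fixes A B C :: "'a :: ring mat"
  assumes "dim_col B = dim_row A" "dim_row C = dim_row B" "dim_col C = dim_col B"
  shows "(B + C) * A = B * A + C * A" "(B - C) * A = B * A - C * A"
proof -
  have c: "B \<in> carrier_mat (dim_row B) (dim_row A)" 
    "C \<in> carrier_mat (dim_row B) (dim_row A)" "A \<in> carrier_mat (dim_row A) (dim_col A)" using assms by auto
  show "(B + C) * A = B * A + C * A" by (rule add_mult_distrib_mat[OF c])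
  show "(B - C) * A = B * A - C * A" by (rule minus_mult_distrib_mat[OF c])
qed


lemma left_inverse_mult_cancel:
  fixes L P M :: "'a :: semiring_1 mat"
  assumes "L * P = 1\<^sub>m r" "P \<in> carrier_mat n r" "L \<in> carrier_mat r n" "M \<in> carrier_mat r m"
  shows "L * (P * M) = M"
  using assms by (metis assoc_mult_mat left_mult_one_mat)

section \<open>Sums of three square-zero matrices\<close>

definition sum_of_three_square_zero :: "nat \<Rightarrow> 'a :: field mat \<Rightarrow> bool" where
  "sum_of_three_square_zero n M \<longleftrightarrow>
    (\<exists>S\<^sub>1 \<in> carrier_mat n n. \<exists>S\<^sub>2 \<in> carrier_mat n n. \<exists>S\<^sub>3 \<in> carrier_mat n n.
      square_zero S\<^sub>1 \<and> square_zero S\<^sub>2 \<and> square_zero S\<^sub>3 \<and> M = S\<^sub>1 + S\<^sub>2 + S\<^sub>3)"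

lemma square_zero_iff:
  "S \<in> carrier_mat n n \<Longrightarrow> square_zero S \<longleftrightarrow> S * S = 0\<^sub>m n n"
  unfolding square_zero_def by (auto simp: numeral_2_eq_2)

lemma square_zero_conjugate:
  assumes S: "S \<in> carrier_mat n n" "square_zero S"
    and P: "P \<in> carrier_mat n n" and Q: "Q \<in> carrier_mat n n" and QP: "Q * P = 1\<^sub>m n"
  shows "square_zero (P * S * Q)"
proof -
  have "P * S * Q * (P * S * Q) = P * (S * ((Q * P) * (S * Q)))"
    using S P Q by (simp add: mult_assoc_dim)
  also have "\<dots> = P * ((S * S) * Q)"
    unfolding QP using S P Q by (simp add: mult_assoc_dim)
  also have "\<dots> = 0\<^sub>m n n"
    using S P Q by (simp add: square_zero_iff[of S n])
  finally show ?thesis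
    using S P Q by (simp add: square_zero_iff[of _ n])
qed

lemma sum_of_three_square_zero_similar:
  assumes A: "similar_mat A B" "A \<in> carrier_mat n n" and B: "sum_of_three_square_zero n B"
  shows "sum_of_three_square_zero n A"
proof -
  obtain P Q where "similar_mat_wit A B P Q"
    using A(1) by (auto simp: similar_mat_def)
  note PQ = similar_mat_witD2[OF A(2) this]
  obtain S1 S2 S3 where S: "S1 \<in> carrier_mat n n" "S2 \<in> carrier_mat n n" "S3 \<in> carrier_mat n n"
    and sq: "square_zero S1" "square_zero S2" "square_zero S3" and eq: "B = S1 + S2 + S3"
    using B by (auto simp: sum_of_three_square_zero_def)
  have "A = P * S1 * Q + P * S2 * Q + P * S3 * Q"
    unfolding PQ(3) eq using PQ(6,7) S
    by (intro eq_matI)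
      (auto simp: distrib_left_dim distrib_right_dim mult_assoc_dim simp del: index_mult_mat(1))
  moreover have "square_zero (P * S1 * Q)" "square_zero (P * S2 * Q)" "square_zero (P * S3 * Q)"
    using square_zero_conjugate[OF _ _ PQ(6,7,2)] S sq by auto
  moreover have "P * S1 * Q \<in> carrier_mat n n" "P * S2 * Q \<in> carrier_mat n n" "P * S3 * Q \<in> carrier_mat n n"
    using PQ(6,7) S by auto
  ultimately show ?thesis
    unfolding sum_of_three_square_zero_def by blast
qed

text \<open>The off-diagonal blocks are at our disposal: whatever they are, a strictly block upper and a
  strictly block lower triangular matrix, both square-zero, correct them. So only the diagonal
  blocks \<open>X * Y\<close> and \<open>- (Y * X)\<close> have to come from a square-zero matrix. The one used
  is the block column \<open>(X, Y * X)\<close> times the block row \<open>(Y, - 1)\<close>; it squares to zero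
  because the row times the column is \<open>Y * X - Y * X = 0\<close>.\<close>

lemma sum_of_three_square_zero_swapped_diagonal:
  fixes X Y B C :: "'a :: field mat"
  assumes X: "X \<in> carrier_mat n n" and Y: "Y \<in> carrier_mat n n"
    and B: "B \<in> carrier_mat n n" and C: "C \<in> carrier_mat n n"
  shows "sum_of_three_square_zero (2 * n) (four_block_mat (X * Y) B C (- (Y * X)))"
proof -
  let ?Z = "0\<^sub>m n n :: 'a mat"
  define S1 where "S1 = four_block_mat (X * Y) (- X) (Y * (X * Y)) (- (Y * X))"
  define S2 where "S2 = four_block_mat ?Z (B + X) ?Z ?Z"
  define S3 where "S3 = four_block_mat ?Z ?Z (C - Y * (X * Y)) ?Z"
  have c: "X * Y \<in> carrier_mat n n" "- X \<in> carrier_mat n n" "Y * (X * Y) \<in> carrier_mat n n"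
    "- (Y * X) \<in> carrier_mat n n" "B + X \<in> carrier_mat n n" "C - Y * (X * Y) \<in> carrier_mat n n"
    "?Z \<in> carrier_mat n n"
    using assms by auto
  have carrier: "S1 \<in> carrier_mat (2 * n) (2 * n)" "S2 \<in> carrier_mat (2 * n) (2 * n)"
    "S3 \<in> carrier_mat (2 * n) (2 * n)"
    using c by (auto simp: S1_def S2_def S3_def mult_2)
  have "S1 * S1 = four_block_mat ?Z ?Z ?Z ?Z"
    unfolding S1_def mult_four_block_mat[OF c(1-4) c(1-4)]
    using X Y
    by (intro cong_four_block_mat; intro eq_matI)
      (auto simp: distrib_left_dim distrib_right_dim mult_assoc_dim simp del: index_mult_mat(1))
  moreover have "S2 * S2 = four_block_mat ?Z ?Z ?Z ?Z"
    unfolding S2_def mult_four_block_mat[OF c(7,5,7,7) c(7,5,7,7)]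
    using X B by (intro cong_four_block_mat) simp_all
  moreover have "S3 * S3 = four_block_mat ?Z ?Z ?Z ?Z"
    unfolding S3_def mult_four_block_mat[OF c(7,7,6,7) c(7,7,6,7)]
    using X Y C by (intro cong_four_block_mat) simp_all
  moreover have "four_block_mat ?Z ?Z ?Z ?Z = 0\<^sub>m (2 * n) (2 * n)"
    unfolding mult_2 by (rule four_block_zero_mat)
  ultimately have "square_zero S1" "square_zero S2" "square_zero S3"
    using carrier by (simp_all only: square_zero_iff)
  moreover have "four_block_mat (X * Y) B C (- (Y * X)) = S1 + S2 + S3"
    by (rule eq_matI) (use X Y B C in \<open>auto simp: S1_def S2_def S3_def simp del: index_mult_mat(1)\<close>)
  ultimately show ?thesis
    using carrier unfolding sum_of_three_square_zero_def by blast
qed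

lemma similar_shear_upper:
  fixes A B C D H :: "'a :: ring_1 mat"
  assumes A: "A \<in> carrier_mat n n" and B: "B \<in> carrier_mat n m" and C: "C \<in> carrier_mat m n"
    and D: "D \<in> carrier_mat m m" and H: "H \<in> carrier_mat n m"
  shows "similar_mat_wit (four_block_mat A B C D)
    (four_block_mat (A - H * C) ((A - H * C) * H + (B - H * D)) C (C * H + D))
    (four_block_mat (1\<^sub>m n) H (0\<^sub>m m n) (1\<^sub>m m)) (four_block_mat (1\<^sub>m n) (- H) (0\<^sub>m m n) (1\<^sub>m m))"
    (is "similar_mat_wit ?M ?M' ?S ?T")
proof (rule similar_mat_witI)
  have I: "1\<^sub>m n \<in> carrier_mat n n" "1\<^sub>m m \<in> carrier_mat m m" "0\<^sub>m m n \<in> carrier_mat m n"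
    "- H \<in> carrier_mat n m" using H by auto
  have A': "A - H * C \<in> carrier_mat n n" "(A - H * C) * H + (B - H * D) \<in> carrier_mat n m"
    "C * H + D \<in> carrier_mat m m" using assms by auto
  show "?S * ?T = 1\<^sub>m (n + m)"
    unfolding mult_four_block_mat[OF I(1) H I(3,2) I(1,4,3,2)] four_block_one_mat[symmetric]
    using H by (intro cong_four_block_mat; intro eq_matI) auto
  show "?T * ?S = 1\<^sub>m (n + m)"
    unfolding mult_four_block_mat[OF I(1,4,3,2) I(1) H I(3,2)] four_block_one_mat[symmetric]
    using H by (intro cong_four_block_mat; intro eq_matI) auto
  have SM: "?S * ?M' = four_block_mat A (A * H + B) C (C * H + D)"
    unfolding mult_four_block_mat[OF I(1) H I(3,2) A'(1,2) C A'(3)]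
    using assms
    by (intro cong_four_block_mat; intro eq_matI)
      (auto simp: distrib_left_dim distrib_right_dim mult_assoc_dim simp del: index_mult_mat(1))
  have AH: "A * H + B \<in> carrier_mat n m" using assms by auto
  show "?M = ?S * ?M' * ?T"
    unfolding SM mult_four_block_mat[OF A AH C A'(3) I(1,4,3,2)]
    using assms
    by (intro cong_four_block_mat; intro eq_matI)
      (auto simp: distrib_left_dim distrib_right_dim mult_assoc_dim simp del: index_mult_mat(1))
qed (use assms in auto)

lemma similar_shear_lower:
  fixes A B C D G :: "'a :: ring_1 mat"
  assumes A: "A \<in> carrier_mat n n" and B: "B \<in> carrier_mat n m" and C: "C \<in> carrier_mat m n"
    and D: "D \<in> carrier_mat m m" and G: "G \<in> carrier_mat m n"
  shows "similar_mat_wit (four_block_mat A B C D)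
    (four_block_mat (A + B * G) B (C + D * G - G * (A + B * G)) (D - G * B))
    (four_block_mat (1\<^sub>m n) (0\<^sub>m n m) G (1\<^sub>m m)) (four_block_mat (1\<^sub>m n) (0\<^sub>m n m) (- G) (1\<^sub>m m))"
    (is "similar_mat_wit ?M ?M' ?S ?T")
proof (rule similar_mat_witI)
  have I: "1\<^sub>m n \<in> carrier_mat n n" "1\<^sub>m m \<in> carrier_mat m m" "0\<^sub>m n m \<in> carrier_mat n m"
    "- G \<in> carrier_mat m n" using G by auto
  have A': "A + B * G \<in> carrier_mat n n" "C + D * G - G * (A + B * G) \<in> carrier_mat m n"
    "D - G * B \<in> carrier_mat m m" using assms by auto
  show "?S * ?T = 1\<^sub>m (n + m)"
    unfolding mult_four_block_mat[OF I(1,3) G I(2) I(1,3,4,2)] four_block_one_mat[symmetric]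
    using G by (intro cong_four_block_mat; intro eq_matI) auto
  show "?T * ?S = 1\<^sub>m (n + m)"
    unfolding mult_four_block_mat[OF I(1,3,4,2) I(1,3) G I(2)] four_block_one_mat[symmetric]
    using G by (intro cong_four_block_mat; intro eq_matI) auto
  have SM: "?S * ?M' = four_block_mat (A + B * G) B (C + D * G) D"
    unfolding mult_four_block_mat[OF I(1,3) G I(2) A'(1) B A'(2,3)]
    using assms
    by (intro cong_four_block_mat; intro eq_matI)
      (auto simp: distrib_left_dim distrib_right_dim mult_assoc_dim simp del: index_mult_mat(1))
  have CD: "C + D * G \<in> carrier_mat m n" using assms by auto
  show "?M = ?S * ?M' * ?T"
    unfolding SM mult_four_block_mat[OF A'(1) B CD D I(1,3,4,2)]
    using assms
    by (intro cong_four_block_mat; intro eq_matI)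
      (auto simp: distrib_left_dim distrib_right_dim mult_assoc_dim simp del: index_mult_mat(1))
qed (use assms in auto)

text \<open>The commutator identity for the smaller matrix \<open>Q * P\<close> suffices. Conjugating
  \<open>P * Q \<oplus> 0\<close> by an upper shear with \<open>H = R * L\<close> puts \<open>P * L\<close> into the
  upper right block, since \<open>P * Q * R * L = P * L\<close>. The matrix \<open>P * L\<close> is a projection
  onto the column space of \<open>P * Q\<close>, so a lower shear with \<open>G\<close> can now add any
  matrix \<open>G\<close> whose columns lie in that space to the upper left block; the lower right block
  becomes \<open>- G * P * L\<close>. Put \<open>X' = P * X * L\<close> and \<open>Y' = P * Y * L\<close>. Choosing \<open>G\<close>
  so that the upper left block is \<open>X' * Y'\<close> turns the lower right one into \<open>- (Y' * X')\<close>,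
  exactly because \<open>Q * P = X * Y - Y * X\<close>.\<close>

lemma sum_of_three_square_zero_if_core_commutator:
  fixes P Q L R X Y :: "'a :: field mat"
  assumes P: "P \<in> carrier_mat n r" and Q: "Q \<in> carrier_mat r n"
    and L: "L \<in> carrier_mat r n" and R: "R \<in> carrier_mat n r"
    and LP: "L * P = 1\<^sub>m r" and QR: "Q * R = 1\<^sub>m r"
    and X: "X \<in> carrier_mat r r" and Y: "Y \<in> carrier_mat r r"
    and comm: "Q * P = X * Y - Y * X"
  shows "sum_of_three_square_zero (2 * n) (direct_sum_zero (P * Q) n)"
proof -
  let ?A = "P * Q" and ?Z = "0\<^sub>m n n :: 'a mat"
  define H where "H = R * L"
  define G where "G = P * (X * Y * L - Q)"
  define X' where "X' = P * X * L"
  define Y' where "Y' = P * Y * L"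
  have A: "?A \<in> carrier_mat n n" and Z: "?Z \<in> carrier_mat n n" and H: "H \<in> carrier_mat n n"
    and G: "G \<in> carrier_mat n n" and X': "X' \<in> carrier_mat n n" and Y': "Y' \<in> carrier_mat n n"
    using P Q L R X Y by (auto simp: H_def G_def X'_def Y'_def)
  have cancel: "L * (P * M) = M" "Q * (R * M) = M" if "M \<in> carrier_mat r m" for M m
    using left_inverse_mult_cancel[OF LP P L that] left_inverse_mult_cancel[OF QR R Q that] by auto
  have minus_zero: "M - ?Z = M" if "M \<in> carrier_mat n n" for M
    using that by (intro eq_matI) auto
  have AH: "?A * H = P * L"
    using P Q L R by (simp add: H_def mult_assoc_dim cancel[of _ n])
  have PLG: "P * L * G = G"
    using P Q L R X Y by (simp add: G_def mult_assoc_dim minus_carrier_mat cancel[of _ n])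
  have XY': "X' * Y' = P * (X * (Y * L))" and YX': "Y' * X' = P * (Y * (X * L))"
    using P L X Y by (simp_all add: X'_def Y'_def mult_assoc_dim cancel[of _ n])
  have AG: "?A + G = X' * Y'"
    unfolding XY' G_def using P Q L X Y
    by (intro eq_matI) (auto simp: distrib_left_dim mult_assoc_dim simp del: index_mult_mat(1))
  have "G * (P * L) = P * ((X * Y * (L * P) - Q * P) * L)"
    unfolding G_def using P Q L X Y
    by (simp add: distrib_left_dim distrib_right_dim mult_assoc_dim)
  also have "X * Y * (L * P) - Q * P = Y * X"
    unfolding LP comm using X Y by (intro eq_matI) (auto simp del: index_mult_mat(1))
  finally have GPL: "G * (P * L) = Y' * X'"
    unfolding YX' using Y X L by (simp add: mult_assoc_dim)
  have "similar_mat (direct_sum_zero ?A n) (four_block_mat ?A (?A * H) ?Z ?Z)"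
  proof -
    have "?A - H * ?Z = ?A" "(?A - H * ?Z) * H + (?Z - H * ?Z) = ?A * H" "?Z * H + ?Z = ?Z"
      using A H by (auto simp: minus_zero)
    with similar_shear_upper[OF A Z Z Z H] P Q show ?thesis
      unfolding similar_mat_def direct_sum_zero_def by auto
  qed
  also have "similar_mat \<dots> (four_block_mat (X' * Y') (P * L) (?Z - G * (X' * Y')) (- (Y' * X')))"
  proof -
    have PL: "P * L \<in> carrier_mat n n" using P L by auto
    have "?Z + ?Z * G - G * (?A + P * L * G) = ?Z - G * (X' * Y')"
      "?Z - G * (P * L) = - (Y' * X')"
      unfolding PLG GPL AG using G X' Y' by auto
    with similar_shear_lower[OF A PL Z Z G] show ?thesis
      unfolding similar_mat_def AH PLG AG by auto
  qed
  finally (similar_mat_trans) have sim: "similar_mat (direct_sum_zero ?A n)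
    (four_block_mat (X' * Y') (P * L) (?Z - G * (X' * Y')) (- (Y' * X')))" .
  show ?thesis
  proof (rule sum_of_three_square_zero_similar[OF sim])
    show "direct_sum_zero ?A n \<in> carrier_mat (2 * n) (2 * n)"
      using P Q by (auto simp: direct_sum_zero_def mult_2)
    show "sum_of_three_square_zero (2 * n)
      (four_block_mat (X' * Y') (P * L) (?Z - G * (X' * Y')) (- (Y' * X')))"
      using P L G X' Y' by (intro sum_of_three_square_zero_swapped_diagonal) auto
  qed
qed

section \<open>Full rank factorization\<close>

lemma append_rows_left_inverse:
  fixes P c L ell :: "'a :: field mat"
  assumes "P \<in> carrier_mat n m" "c \<in> carrier_mat n 1"
    and "L \<in> carrier_mat m n" "ell \<in> carrier_mat 1 n"
    and "L * P = 1\<^sub>m m" "L * c = 0\<^sub>m m 1" "ell * P = 0\<^sub>m 1 m" "ell * c = 1\<^sub>m 1"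
  shows "four_block_mat L (0\<^sub>m m 0) ell (0\<^sub>m 1 0) * four_block_mat P c (0\<^sub>m 0 m) (0\<^sub>m 0 1) = 1\<^sub>m (m + 1)"
  using assms unfolding four_block_one_mat[symmetric]
  by (subst mult_four_block_mat[where ?nr1.0 = m and ?n1.0 = n and ?n2.0 = 0 and ?nr2.0 = 1
    and ?nc1.0 = m and ?nc2.0 = 1]) auto

text \<open>Induction on the columns. Given \<open>A\<^sub>0 = P * Q\<close> and a further column \<open>c\<close>, the projection
  \<open>P * L\<close> splits \<open>c\<close> as \<open>P * l + d\<close> with \<open>l = L * c\<close> and \<open>L * d = 0\<close>. If
  \<open>d = 0\<close>, the factor \<open>P\<close> suffices and \<open>Q\<close> gains the column \<open>l\<close>. Otherwise
  \<open>d\<close> becomes a new column of \<open>P\<close>, and \<open>L\<close> gains a row that reads off a nonzero entry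
  of \<open>d\<close> after removing the component in the column space of \<open>P\<close>.\<close>

lemma full_rank_factorization:
  fixes A :: "'a :: field mat"
  assumes "A \<in> carrier_mat n k"
  shows "\<exists>r P Q L R. P \<in> carrier_mat n r \<and> Q \<in> carrier_mat r k \<and> L \<in> carrier_mat r n \<and>
    R \<in> carrier_mat k r \<and> A = P * Q \<and> L * P = 1\<^sub>m r \<and> Q * R = 1\<^sub>m r"
  using assms
proof (induction k arbitrary: A)
  case 0
  then show ?case
    by (intro exI[of _ 0] exI[of _ "0\<^sub>m n 0"] exI[of _ "0\<^sub>m 0 0"] exI[of _ "0\<^sub>m 0 n"]) (auto intro!: eq_matI)
next
  case (Suc k)
  obtain A0 c Z0 Z1 where split: "split_block A n k = (A0, c, Z0, Z1)"
    by (metis prod_cases4)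
  have A0: "A0 \<in> carrier_mat n k" and c: "c \<in> carrier_mat n 1"
    and A: "A = four_block_mat A0 c (0\<^sub>m 0 k) (0\<^sub>m 0 1)"
    using split_block[OF split, of 0 1] Suc.prems by (auto intro!: eq_matI)
  obtain m P Q L R where PQ: "P \<in> carrier_mat n m" "Q \<in> carrier_mat m k" "L \<in> carrier_mat m n"
    "R \<in> carrier_mat k m" and A0_eq: "A0 = P * Q" and LP: "L * P = 1\<^sub>m m" and QR: "Q * R = 1\<^sub>m m"
    using Suc.IH[OF A0] by blast
  define l where "l = L * c"
  define d where "d = c - P * l"
  have l: "l \<in> carrier_mat m 1" using PQ c by (auto simp: l_def)
  have d: "d \<in> carrier_mat n 1" and c_eq: "c = P * l + d"
    using c PQ by (auto simp: d_def l_def intro!: eq_matI simp del: index_mult_mat(1))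
  have LPx: "L * (P * M) = M" if "M \<in> carrier_mat m j" for M j
    using left_inverse_mult_cancel[OF LP PQ(1,3) that] .
  have Ld: "L * d = 0\<^sub>m m 1"
    using c PQ unfolding d_def l_def by (simp add: distrib_left_dim LPx[of _ 1])
  have Pld: "P * l + d = c" using c_eq by (rule sym)
  show ?case
  proof (cases "d = 0\<^sub>m n 1")
    case True
    define Q' where "Q' = four_block_mat Q l (0\<^sub>m 0 k) (0\<^sub>m 0 1)"
    define R' where "R' = four_block_mat R (0\<^sub>m k 0) (0\<^sub>m 1 m) (0\<^sub>m 1 0)"
    have Q': "Q' \<in> carrier_mat m (Suc k)" and R': "R' \<in> carrier_mat (Suc k) m"
      unfolding Q'_def R'_def using PQ l by (auto intro!: carrier_matI)
    have one0: "0\<^sub>m 0 0 = (1\<^sub>m 0 :: 'a mat)"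
      by (intro eq_matI) simp_all
    have "P * l = c"
      using Pld PQ l unfolding True by simp
    then have "four_block_mat P (0\<^sub>m n 0) (0\<^sub>m 0 m) (0\<^sub>m 0 0) * Q' = A"
      unfolding Q'_def A A0_eq
        mult_four_block_mat[OF PQ(1) zero_carrier_mat zero_carrier_mat zero_carrier_mat
          PQ(2) l zero_carrier_mat zero_carrier_mat]
      using PQ l c by (intro cong_four_block_mat) simp_all
    moreover have "four_block_mat P (0\<^sub>m n 0) (0\<^sub>m 0 m) (0\<^sub>m 0 0) = P"
      using PQ by (intro eq_matI) auto
    ultimately have "A = P * Q'"
      by simp
    moreover have "Q' * R' = 1\<^sub>m (m + 0)"
      unfolding Q'_def R'_def four_block_one_mat[symmetric]
        mult_four_block_mat[OF PQ(2) l zero_carrier_mat zero_carrier_mat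
          PQ(4) zero_carrier_mat zero_carrier_mat zero_carrier_mat]
      using PQ l QR by (intro cong_four_block_mat) (simp_all flip: one0)
    ultimately show ?thesis
      using PQ LP Q' R' by (metis add_0_right)
  next
    case False
    then obtain i where i: "i < n" "d $$ (i, 0) \<noteq> 0"
      using d by (metis carrier_matD eq_matI index_zero_mat less_one)
    define e where "e = mat 1 n (\<lambda>(_, j). if j = i then 1 / d $$ (i, 0) else 0)"
    \<comment> \<open>\<open>e\<close> reads off the chosen entry of \<open>d\<close>, normalized; \<open>ell\<close> in addition annihilates \<open>P\<close>.\<close>
    define ell where "ell = e - e * (P * L)"
    have e: "e \<in> carrier_mat 1 n" and ell: "ell \<in> carrier_mat 1 n"
      using PQ by (auto simp: e_def ell_def)
    define P' where "P' = four_block_mat P d (0\<^sub>m 0 m) (0\<^sub>m 0 1)"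
    define Q' where "Q' = four_block_mat Q l (0\<^sub>m 1 k) (1\<^sub>m 1)"
    define L' where "L' = four_block_mat L (0\<^sub>m m 0) ell (0\<^sub>m 1 0)"
    define R' where "R' = four_block_mat R (- (R * l)) (0\<^sub>m 1 m) (1\<^sub>m 1)"
    have "ell * P = 0\<^sub>m 1 m"
      unfolding ell_def using PQ e LP by (simp add: distrib_right_dim mult_assoc_dim)
    moreover have "ell * d = 1\<^sub>m 1"
    proof -
      have "ell * d = e * d"
        unfolding ell_def using PQ e d Ld
        by (intro eq_matI) (auto simp: distrib_right_dim mult_assoc_dim simp del: index_mult_mat(1))
      also have "\<dots> = 1\<^sub>m 1"
        using i d by (intro eq_matI) (auto simp: e_def scalar_prod_def if_distrib[of "\<lambda>x. x * _"] cong: if_cong)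
      finally show ?thesis .
    qed
    ultimately have LP': "L' * P' = 1\<^sub>m (m + 1)"
      unfolding L'_def P'_def using append_rows_left_inverse PQ d ell LP Ld by blast
    have QRl: "Q * (R * l) = l"
      using left_inverse_mult_cancel[OF QR PQ(4,2) l] .
    have Rl: "- (R * l) \<in> carrier_mat k 1" using PQ l by auto
    have neg0: "- 0\<^sub>m 1 1 = (0\<^sub>m 1 1 :: 'a mat)"
      by (intro eq_matI) simp_all
    have QR': "Q' * R' = 1\<^sub>m (m + 1)"
      unfolding Q'_def R'_def four_block_one_mat[symmetric]
        mult_four_block_mat[OF PQ(2) l zero_carrier_mat one_carrier_mat
          PQ(4) Rl zero_carrier_mat one_carrier_mat]
      using PQ l QR QRl neg0 by (intro cong_four_block_mat) simp_all
    have "P' * Q' = A"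
      unfolding P'_def Q'_def A A0_eq
        mult_four_block_mat[OF PQ(1) d zero_carrier_mat zero_carrier_mat
          PQ(2) l zero_carrier_mat one_carrier_mat]
      using Pld PQ l d by (intro cong_four_block_mat) simp_all
    moreover have "P' \<in> carrier_mat n (m + 1)" "Q' \<in> carrier_mat (m + 1) (Suc k)"
      "L' \<in> carrier_mat (m + 1) n" "R' \<in> carrier_mat (Suc k) (m + 1)"
      unfolding P'_def Q'_def L'_def R'_def using PQ d ell Rl l by (auto intro!: carrier_matI)
    ultimately show ?thesis
      using LP' QR' by metis
  qed
qed

section \<open>Commutators with shift matrices\<close>

definition shift_mat :: "nat \<Rightarrow> 'a :: field mat" where
  "shift_mat n = mat n n (\<lambda>(i, j). if j = Suc i then 1 else 0)"

lemma shift_mat_carrier [simp]: "shift_mat n \<in> carrier_mat n n"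
  by (simp add: shift_mat_def)

lemma shift_mat_dim [simp]: "dim_row (shift_mat n) = n" "dim_col (shift_mat n) = n"
  by (simp_all add: shift_mat_def)

lemma shift_mat_mult_index:
  assumes "Y \<in> carrier_mat h k" "i < h" "j < k"
  shows "(shift_mat h * Y) $$ (i, j) = (if Suc i < h then Y $$ (Suc i, j) else 0)"
    and "(Y * shift_mat k) $$ (i, j) = (if j = 0 then 0 else Y $$ (i, j - 1))"
proof -
  have "(shift_mat h * Y) $$ (i, j) = (\<Sum>l = 0..<h. if l = Suc i then Y $$ (l, j) else 0)"
    using assms by (auto simp: shift_mat_def scalar_prod_def if_distrib[of "\<lambda>x. x * _"] cong: if_cong)
  then show "(shift_mat h * Y) $$ (i, j) = (if Suc i < h then Y $$ (Suc i, j) else 0)"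
    by simp
  have "(Y * shift_mat k) $$ (i, j) = (\<Sum>l = 0..<k. if j = Suc l then Y $$ (i, l) else 0)"
    using assms by (auto simp: shift_mat_def scalar_prod_def intro!: sum.cong)
  also have "\<dots> = (if j = 0 then 0 else Y $$ (i, j - 1))"
    using assms by (cases j) simp_all
  finally show "(Y * shift_mat k) $$ (i, j) = (if j = 0 then 0 else Y $$ (i, j - 1))" .
qed

text \<open>Entrywise the equation says \<open>T\<^sub>i\<^sub>j = Y\<^sub>i\<^sub>+\<^sub>1\<^sub>,\<^sub>j - Y\<^sub>i\<^sub>,\<^sub>j\<^sub>-\<^sub>1\<close>, where entries outside the matrix
  count as zero. It determines the rows of \<open>Y\<close> one after the other, starting from a zero row.
  The only obstruction is that the row after the last one must vanish. Its
  entries are sums of \<open>T\<close> along diagonals: below the main diagonal they vanish because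
  \<open>T\<close> is triangular, and on it the sum is the trace.\<close>

lemma upper_triangular_shift_commutator:
  fixes T :: "'a :: field mat"
  assumes T: "T \<in> carrier_mat h h" and upper: "\<And>i j. i < h \<Longrightarrow> j < i \<Longrightarrow> T $$ (i, j) = 0"
    and trace: "(\<Sum>i<h. T $$ (i, i)) = 0"
  shows "\<exists>Y \<in> carrier_mat h h. T = shift_mat h * Y - Y * shift_mat h"
proof -
  \<comment> \<open>Row \<open>h\<close> is defined as well although \<open>Y\<close> has rows \<open>0..<h\<close> only: it is the row that must vanish.\<close>
  define y where "y = rec_nat (\<lambda>j :: nat. 0) (\<lambda>i yi j. T $$ (i, j) + (if j = 0 then 0 else yi (j - 1)))"
  have y_0: "y 0 j = 0"
    and y_Suc: "y (Suc i) j = T $$ (i, j) + (if j = 0 then 0 else y i (j - 1))" for i j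
    by (simp_all add: y_def)
  have below: "y i j = 0" if "i \<le> h" "Suc j < i" for i j
    using that by (induction i arbitrary: j) (auto simp: y_0 y_Suc upper)
  have partial_trace: "y (Suc i) i = (\<Sum>l\<le>i. T $$ (l, l))" for i
    by (induction i) (simp_all add: y_0 y_Suc[of _ "_ :: nat"])
  have last: "y h j = 0" if "j < h" for j
  proof (cases "Suc j = h")
    case True
    then have "y h j = (\<Sum>l<h. T $$ (l, l))"
      using partial_trace[of j] by (simp add: lessThan_Suc_atMost[symmetric])
    then show ?thesis using trace by simp
  next
    case False
    then show ?thesis using that by (intro below) auto
  qed
  define Y where "Y = mat h h (\<lambda>(i, j). y i j)"
  have Y: "Y \<in> carrier_mat h h" by (simp add: Y_def)
  have "T = shift_mat h * Y - Y * shift_mat h"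
  proof (rule eq_matI)
    fix i j
    assume "i < dim_row (shift_mat h * Y - Y * shift_mat h)"
      and "j < dim_col (shift_mat h * Y - Y * shift_mat h)"
    then have ij: "i < h" "j < h"
      using Y by (auto simp: shift_mat_def)
    have Suc_i: "(if Suc i < h then Y $$ (Suc i, j) else 0) = y (Suc i) j"
    proof (cases "Suc i < h")
      case False
      then have "Suc i = h" using ij by simp
      then show ?thesis using last[of j] ij by simp
    qed (use ij in \<open>simp add: Y_def\<close>)
    show "T $$ (i, j) = (shift_mat h * Y - Y * shift_mat h) $$ (i, j)"
      using ij Y shift_mat_mult_index[OF Y ij] unfolding Suc_i
      by (simp add: y_Suc Y_def shift_mat_def del: index_mult_mat(1))
  qed (use T in \<open>simp_all add: shift_mat_def Y_def\<close>)
  with Y show ?thesis by blast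
qed

text \<open>The entries of the solution \<open>W\<close> of \<open>W = a (J W - W J' - B)\<close>, for shift matrices \<open>J\<close> and
  \<open>J'\<close>. The recursion moves down or to the left, hence terminates: this is the nilpotency
  of \<open>W \<mapsto> J W - W J'\<close>.\<close>

function nilpotent_sylvester_entry ::
    "nat \<Rightarrow> 'a :: field \<Rightarrow> 'a mat \<Rightarrow> nat \<Rightarrow> nat \<Rightarrow> 'a" where
  "nilpotent_sylvester_entry h a B i j =
    a * ((if Suc i < h then nilpotent_sylvester_entry h a B (Suc i) j else 0)
       - (if j = 0 then 0 else nilpotent_sylvester_entry h a B i (j - 1)) - B $$ (i, j))"
  by auto
termination
  by (relation "measure (\<lambda>(h, a, B, i, j). (h - i) + j)") auto

declare nilpotent_sylvester_entry.simps [simp del]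

lemma nilpotent_sylvester:
  fixes B :: "'a :: field mat"
  assumes B: "B \<in> carrier_mat h k"
  shows "\<exists>W \<in> carrier_mat h k. W = a \<cdot>\<^sub>m (shift_mat h * W - W * shift_mat k - B)"
proof -
  define W where "W = mat h k (\<lambda>(i, j). nilpotent_sylvester_entry h a B i j)"
  have W: "W \<in> carrier_mat h k" by (simp add: W_def)
  have "W = a \<cdot>\<^sub>m (shift_mat h * W - W * shift_mat k - B)"
  proof (rule eq_matI)
    fix i j
    assume "i < dim_row (a \<cdot>\<^sub>m (shift_mat h * W - W * shift_mat k - B))"
      and "j < dim_col (a \<cdot>\<^sub>m (shift_mat h * W - W * shift_mat k - B))"
    then have ij: "i < h" "j < k" using B by auto
    have "W $$ (i, j) = nilpotent_sylvester_entry h a B i j"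
      using ij by (simp add: W_def)
    also have "\<dots> = a * ((if Suc i < h then W $$ (Suc i, j) else 0)
       - (if j = 0 then 0 else W $$ (i, j - 1)) - B $$ (i, j))"
      using ij by (subst nilpotent_sylvester_entry.simps) (simp add: W_def)
    also have "\<dots> = (a \<cdot>\<^sub>m (shift_mat h * W - W * shift_mat k - B)) $$ (i, j)"
      using ij W B shift_mat_mult_index[OF W ij]
      by (simp add: shift_mat_def del: index_mult_mat(1))
    finally show "W $$ (i, j) = (a \<cdot>\<^sub>m (shift_mat h * W - W * shift_mat k - B)) $$ (i, j)" .
  qed (use B in \<open>simp_all add: W_def\<close>)
  with W show ?thesis by blast
qed

section \<open>Commutators from two-coloured matrices\<close>

definition is_commutator :: "nat \<Rightarrow> 'a :: field mat \<Rightarrow> bool" where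
  "is_commutator n A \<longleftrightarrow> (\<exists>X \<in> carrier_mat n n. \<exists>Y \<in> carrier_mat n n. A = X * Y - Y * X)"

text \<open>The left factor of the commutator is \<open>J \<oplus> (1 + J')\<close> with shift matrices \<open>J\<close> and
  \<open>J'\<close>. On the diagonal blocks the summand \<open>1\<close> is central, so the triangular case
  applies to both. On the off-diagonal blocks the two eigenvalues \<open>0\<close> and \<open>1\<close> differ, so
  the Sylvester equations have a solution for every right-hand side. Two eigenvalues exist in
  every field, so the argument covers the small fields as well.\<close>

lemma is_commutator_triangular_blocks:
  fixes T B C N :: "'a :: field mat"
  assumes T: "T \<in> carrier_mat h h" and B: "B \<in> carrier_mat h k"
    and C: "C \<in> carrier_mat k h" and N: "N \<in> carrier_mat k k"
    and T_upper: "\<And>i j. i < h \<Longrightarrow> j < i \<Longrightarrow> T $$ (i, j) = 0"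
    and T_trace: "(\<Sum>i<h. T $$ (i, i)) = 0"
    and N_upper: "\<And>i j. i < k \<Longrightarrow> j \<le> i \<Longrightarrow> N $$ (i, j) = 0"
  shows "is_commutator (h + k) (four_block_mat T B C N)"
proof -
  let ?J = "shift_mat h :: 'a mat" and ?K = "shift_mat k :: 'a mat"
  obtain Y1 where Y1: "Y1 \<in> carrier_mat h h" "T = ?J * Y1 - Y1 * ?J"
    using upper_triangular_shift_commutator[OF T T_upper T_trace] by blast
  have "(\<Sum>i<k. N $$ (i, i)) = 0"
    using N_upper by simp
  then obtain Y2 where Y2: "Y2 \<in> carrier_mat k k" "N = ?K * Y2 - Y2 * ?K"
    using upper_triangular_shift_commutator[OF N] N_upper by force
  \<comment> \<open>For \<open>J U - U (1 + J') = B\<close> the factor is \<open>1\<close>; exchanging the blocks changes the sign of the identity part, so below the factor is \<open>- 1\<close>.\<close>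
  obtain U where U: "U \<in> carrier_mat h k" "U = 1 \<cdot>\<^sub>m (?J * U - U * ?K - B)"
    using nilpotent_sylvester[OF B] by blast
  obtain V where V: "V \<in> carrier_mat k h" "V = (- 1) \<cdot>\<^sub>m (?K * V - V * ?J - C)"
    using nilpotent_sylvester[OF C] by blast
  define K1 where "K1 = 1\<^sub>m k + ?K"
  have K1: "K1 \<in> carrier_mat k k" by (simp add: K1_def)
  define X where "X = four_block_mat ?J (0\<^sub>m h k) (0\<^sub>m k h) K1"
  define Y where "Y = four_block_mat Y1 U V Y2"
  have J: "?J \<in> carrier_mat h h" and K: "?K \<in> carrier_mat k k" by simp_all
  have B': "?J * U - U * K1 = B"
  proof (rule eq_matI)
    fix i j assume "i < dim_row B" "j < dim_col B"
    with B have ij: "i < h" "j < k" by auto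
    have "U $$ (i, j) = (?J * U) $$ (i, j) - (U * ?K) $$ (i, j) - B $$ (i, j)"
      using arg_cong[OF U(2), of "\<lambda>M. M $$ (i, j)"] ij U(1) B K J by (simp del: index_mult_mat(1))
    moreover have "U * K1 = U + U * ?K"
      unfolding K1_def using U(1) K by (simp add: distrib_left_dim)
    ultimately show "(?J * U - U * K1) $$ (i, j) = B $$ (i, j)"
      using ij U(1) K J by (simp del: index_mult_mat(1))
  qed (use U(1) B J K1 in auto)
  have C': "K1 * V - V * ?J = C"
  proof (rule eq_matI)
    fix i j assume "i < dim_row C" "j < dim_col C"
    with C have ij: "i < k" "j < h" by auto
    have "V $$ (i, j) = - ((?K * V) $$ (i, j) - (V * ?J) $$ (i, j) - C $$ (i, j))"
      using arg_cong[OF V(2), of "\<lambda>M. M $$ (i, j)"] ij V(1) C K J by (simp del: index_mult_mat(1))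
    moreover have "K1 * V = V + ?K * V"
      unfolding K1_def using V(1) K by (simp add: distrib_right_dim)
    ultimately show "(K1 * V - V * ?J) $$ (i, j) = C $$ (i, j)"
      using ij V(1) K J by (simp del: index_mult_mat(1))
  qed (use V(1) C J K1 in auto)
  have N': "K1 * Y2 - Y2 * K1 = N"
    unfolding K1_def Y2(2) using Y2(1) K
    by (intro eq_matI) (auto simp: distrib_left_dim distrib_right_dim simp del: index_mult_mat(1))
  have XY: "X * Y = four_block_mat (?J * Y1) (?J * U) (K1 * V) (K1 * Y2)"
    unfolding X_def Y_def
      mult_four_block_mat[OF J zero_carrier_mat zero_carrier_mat K1 Y1(1) U(1) V(1) Y2(1)]
    using mult_carrier_mat[OF J Y1(1)] mult_carrier_mat[OF J U(1)] K1 Y1(1) U(1) V(1) Y2(1)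
    by (intro cong_four_block_mat) simp_all
  have YX: "Y * X = four_block_mat (Y1 * ?J) (U * K1) (V * ?J) (Y2 * K1)"
    unfolding X_def Y_def
      mult_four_block_mat[OF Y1(1) U(1) V(1) Y2(1) J zero_carrier_mat zero_carrier_mat K1]
    using J K1 Y1(1) U(1) V(1) Y2(1) by (intro cong_four_block_mat) simp_all
  have "X * Y - Y * X = four_block_mat (?J * Y1 - Y1 * ?J) (?J * U - U * K1) (K1 * V - V * ?J) (K1 * Y2 - Y2 * K1)"
    unfolding XY YX using J K1 Y1(1) U(1) V(1) Y2(1)
    by (intro eq_matI) (auto simp del: index_mult_mat(1))
  then have "four_block_mat T B C N = X * Y - Y * X"
    unfolding B' C' N' Y1(2)[symmetric] by simp
  moreover have "X \<in> carrier_mat (h + k) (h + k)" "Y \<in> carrier_mat (h + k) (h + k)"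
    unfolding X_def Y_def using J K1 Y1(1) U(1) V(1) Y2(1) by auto
  ultimately show ?thesis
    unfolding is_commutator_def by blast
qed

lemma is_commutator_reindex:
  fixes A :: "'a :: field mat"
  assumes A: "A \<in> carrier_mat n n" and p: "bij_betw p {..<n} {..<n}"
    and comm: "is_commutator n (mat n n (\<lambda>(i, j). A $$ (p i, p j)))"
  shows "is_commutator n A"
proof -
  define q where "q = inv_into {..<n} p"
  have q: "bij_betw q {..<n} {..<n}"
    unfolding q_def using p by (rule bij_betw_inv_into)
  have q_less: "q i < n" and pq: "p (q i) = i" if "i < n" for i
    using that p q unfolding q_def by (auto simp: bij_betw_def f_inv_into_f)
  obtain X Y where X: "X \<in> carrier_mat n n" and Y: "Y \<in> carrier_mat n n"
    and eq: "mat n n (\<lambda>(i, j). A $$ (p i, p j)) = X * Y - Y * X"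
    using comm by (auto simp: is_commutator_def)
  define re where "re M = mat n n (\<lambda>(i, j). M $$ (q i, q j))" for M :: "'a mat"
  have re_mult: "(re M * re M') $$ (i, j) = (M * M') $$ (q i, q j)"
    if "M \<in> carrier_mat n n" "M' \<in> carrier_mat n n" "i < n" "j < n" for M M' i j
  proof -
    have "(re M * re M') $$ (i, j) = (\<Sum>l<n. M $$ (q i, q l) * M' $$ (q l, q j))"
      using that by (simp add: re_def scalar_prod_def lessThan_atLeast0)
    also have "\<dots> = (\<Sum>l<n. M $$ (q i, l) * M' $$ (l, q j))"
      by (rule sum.reindex_bij_betw[OF q])
    also have "\<dots> = (M * M') $$ (q i, q j)"
      using that q_less by (simp add: scalar_prod_def lessThan_atLeast0)
    finally show ?thesis .
  qed
  have "A = re X * re Y - re Y * re X"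
  proof (rule eq_matI)
    fix i j assume "i < dim_row (re X * re Y - re Y * re X)" "j < dim_col (re X * re Y - re Y * re X)"
    then have ij: "i < n" "j < n" by (auto simp: re_def)
    have "A $$ (i, j) = mat n n (\<lambda>(i, j). A $$ (p i, p j)) $$ (q i, q j)"
      using ij by (simp add: q_less pq)
    also have "\<dots> = (X * Y) $$ (q i, q j) - (Y * X) $$ (q i, q j)"
      unfolding eq using X Y ij q_less by (simp del: index_mult_mat(1))
    also have "\<dots> = (re X * re Y - re Y * re X) $$ (i, j)"
      using X Y ij re_mult by (simp add: re_def del: index_mult_mat(1))
    finally show "A $$ (i, j) = (re X * re Y - re Y * re X) $$ (i, j)" .
  qed (use A in \<open>auto simp: re_def\<close>)
  moreover have "re X \<in> carrier_mat n n" "re Y \<in> carrier_mat n n"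
    by (simp_all add: re_def)
  ultimately show ?thesis
    unfolding is_commutator_def by blast
qed

text \<open>The rows and columns are coloured by \<open>s\<close>. Sorting the indices by colour, in their given
  order within each colour, makes the diagonal block of colour \<open>False\<close> upper triangular and that of
  colour \<open>True\<close> strictly upper triangular; entries between different colours are arbitrary.\<close>

definition two_coloured :: "nat \<Rightarrow> (nat \<Rightarrow> bool) \<Rightarrow> 'a :: zero mat \<Rightarrow> bool" where
  "two_coloured n s A \<longleftrightarrow>
    (\<forall>i<n. \<forall>j\<le>i. s i = s j \<longrightarrow> (j < i \<or> s i) \<longrightarrow> A $$ (i, j) = 0)"

lemma is_commutator_two_coloured:
  fixes A :: "'a :: field mat"
  assumes A: "A \<in> carrier_mat n n" and col: "two_coloured n s A"
    and trace: "(\<Sum>i<n. A $$ (i, i)) = 0"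
  shows "is_commutator n A"
proof -
  define us where "us = filter (\<lambda>i. \<not> s i) [0..<n]"
  define vs where "vs = filter s [0..<n]"
  define h where "h = length us"
  define k where "k = length vs"
  define p where "p i = (us @ vs) ! i" for i
  have n: "n = h + k"
    using sum_length_filter_compl[of s "[0..<n]"] by (simp add: h_def k_def us_def vs_def)
  have dist: "distinct (us @ vs)" and set_eq: "set (us @ vs) = {..<n}"
    by (auto simp: us_def vs_def)
  have p: "bij_betw p {..<n} {..<n}"
    using bij_betw_nth[OF dist refl set_eq[symmetric], of] n by (simp add: p_def[abs_def] h_def k_def)
  have p_less: "p i < n" if "i < n" for i
    using p that by (auto simp: bij_betw_def)
  have p_s: "s (p i) \<longleftrightarrow> h \<le> i" if "i < n" for i
  proof (cases "i < h")
    case True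
    then have "p i \<in> set us" by (simp add: p_def nth_append h_def)
    then show ?thesis using True by (simp add: us_def)
  next
    case False
    then have "p i \<in> set vs" using that n by (simp add: p_def nth_append h_def k_def)
    then show ?thesis using False by (simp add: vs_def)
  qed
  have p_mono: "p j < p i" if ij: "j < i" "i < n" "s (p i) = s (p j)" for i j
  proof -
    have sorted: "sorted_wrt (<) us" "sorted_wrt (<) vs"
      unfolding us_def vs_def by (simp_all add: sorted_wrt_filter)
    consider "i < h" | "h \<le> j"
      using ij p_s[of i] p_s[of j] by (metis less_trans not_le)
    then show ?thesis
    proof cases
      case 1
      then show ?thesis
        using ij sorted_wrt_nth_less[OF sorted(1), of j i] by (simp add: p_def nth_append h_def)
    next
      case 2
      then show ?thesis
        using ij n sorted_wrt_nth_less[OF sorted(2), of "j - h" "i - h"]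
        by (simp add: p_def nth_append h_def k_def)
    qed
  qed
  define A' where "A' = mat n n (\<lambda>(i, j). A $$ (p i, p j))"
  have A': "A' \<in> carrier_mat n n" by (simp add: A'_def)
  have A'_zero: "A' $$ (i, j) = 0" if "j < i" "i < n" "h \<le> i \<longleftrightarrow> h \<le> j" for i j
    using that col p_s[of i] p_s[of j] p_less[of i] p_mono[of j i]
    by (auto simp: A'_def two_coloured_def)
  have A'_diag: "A' $$ (i, i) = 0" if "h \<le> i" "i < n" for i
    using that col p_s[of i] p_less[of i] by (auto simp: A'_def two_coloured_def)
  obtain T B C N where split: "split_block A' h h = (T, B, C, N)"
    by (metis prod_cases4)
  have dims: "dim_row A' = h + k" "dim_col A' = h + k" using A' n by auto
  note blocks = split_block[OF split dims]
  have T_index: "T $$ (i, j) = A' $$ (i, j)" if "i < h" "j < h" for i j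
    using split that by (auto simp: split_block_def Let_def)
  have N_index: "N $$ (i, j) = A' $$ (i + h, j + h)" if "i < k" "j < k" for i j
    using split that dims by (auto simp: split_block_def Let_def)
  have "(\<Sum>i<h. T $$ (i, i)) = (\<Sum>i<h. A' $$ (i, i))"
    by (simp add: T_index)
  also have "\<dots> = (\<Sum>i<n. A' $$ (i, i))"
    using A'_diag by (intro sum.mono_neutral_left) (auto simp: n)
  also have "\<dots> = (\<Sum>i<n. A $$ (p i, p i))"
    by (simp add: A'_def)
  also have "\<dots> = 0"
    using sum.reindex_bij_betw[OF p, of "\<lambda>i. A $$ (i, i)"] trace by simp
  finally have trace_T: "(\<Sum>i<h. T $$ (i, i)) = 0" .
  have "is_commutator (h + k) (four_block_mat T B C N)"
  proof (rule is_commutator_triangular_blocks[OF blocks(1-4) _ trace_T])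
    show "T $$ (i, j) = 0" if "i < h" "j < i" for i j
      using that A'_zero[of j i] by (simp add: T_index n)
    show "N $$ (i, j) = 0" if "i < k" "j \<le> i" for i j
      using that A'_zero[of "j + h" "i + h"] A'_diag[of "i + h"]
      by (cases "j = i") (simp_all add: N_index n)
  qed
  then have "is_commutator n A'"
    using blocks(5) n by simp
  then show ?thesis
    unfolding A'_def by (rule is_commutator_reindex[OF A p])
qed

section \<open>Every matrix is similar to a two-coloured one\<close>

definition first_unit :: "nat \<Rightarrow> 'a :: field mat" where
  "first_unit n = mat n 1 (\<lambda>(i, _). if i = 0 then 1 else 0)"

lemma first_unit_carrier [simp]: "first_unit n \<in> carrier_mat n 1" "first_unit n \<in> carrier_mat n (Suc 0)"
  by (simp_all add: first_unit_def)

lemma first_unit_nonzero: "n > 0 \<Longrightarrow> first_unit n \<noteq> (0\<^sub>m n 1 :: 'a :: field mat)"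
  by (auto simp: first_unit_def dest!: arg_cong[where f = "\<lambda>M. M $$ (0, 0)"])

lemma first_unit_Suc:
  "first_unit (Suc n) = four_block_mat (1\<^sub>m 1) (0\<^sub>m 1 0) (0\<^sub>m n 1) (0\<^sub>m n 0)"
  by (intro eq_matI) (auto simp: first_unit_def)

lemma row_with_prescribed_product:
  fixes c :: "'a :: field mat"
  assumes c: "c \<in> carrier_mat n 1" "c \<noteq> 0\<^sub>m n 1" and a: "a \<in> carrier_mat 1 1"
  shows "\<exists>y \<in> carrier_mat 1 n. y * c = a"
proof -
  obtain i where i: "i < n" "c $$ (i, 0) \<noteq> 0"
    using c by (metis carrier_matD eq_matI index_zero_mat less_one)
  define y where "y = mat 1 n (\<lambda>(_, j). if j = i then a $$ (0, 0) / c $$ (i, 0) else 0)"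
  have "y * c = a"
    using i c a
    by (intro eq_matI) (auto simp: y_def scalar_prod_def if_distrib[of "\<lambda>x. x * _"] cong: if_cong)
  then show ?thesis
    by (intro bexI[of _ y]) (simp_all add: y_def)
qed

text \<open>A matrix, viewed as an endomorphism, together with a vector: the two change coordinates
  simultaneously.\<close>

definition similar_pair :: "nat \<Rightarrow> 'a :: field mat \<Rightarrow> 'a mat \<Rightarrow> 'a mat \<Rightarrow> 'a mat \<Rightarrow> bool" where
  "similar_pair n A v B w \<longleftrightarrow> (\<exists>P Q. similar_mat_wit A B P Q \<and> Q * v = w \<and>
    A \<in> carrier_mat n n \<and> v \<in> carrier_mat n 1)"

lemma similar_pair_trans:
  assumes "similar_pair n A u B v" "similar_pair n B v C w"
  shows "similar_pair n A u C w"
proof -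
  obtain P Q P' Q' where 1: "similar_mat_wit A B P Q" "Q * u = v"
    and 2: "similar_mat_wit B C P' Q'" "Q' * v = w"
    and A: "A \<in> carrier_mat n n" and B: "B \<in> carrier_mat n n" and u: "u \<in> carrier_mat n 1"
    using assms by (auto simp: similar_pair_def)
  have "Q' * Q * u = w"
    using similar_mat_witD2(7)[OF A 1(1)] similar_mat_witD2(7)[OF B 2(1)] u 1(2) 2(2)
    by (simp add: mult_assoc_dim)
  then show ?thesis
    using similar_mat_wit_trans[OF 1(1) 2(1)] A u by (auto simp: similar_pair_def)
qed

lemma similar_pair_by:
  assumes "A \<in> carrier_mat n n" "v \<in> carrier_mat n 1"
    and P: "P \<in> carrier_mat n n" and Q: "Q \<in> carrier_mat n n" and "P * Q = 1\<^sub>m n" "Q * P = 1\<^sub>m n"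
    and "Q * v = w"
  shows "similar_pair n A v (Q * A * P) w"
proof -
  have "P * (Q * A * P) * Q = (P * Q) * A * (P * Q)"
    using assms(1) P Q by (simp add: mult_assoc_dim)
  then have "similar_mat_wit A (Q * A * P) P Q"
    using assms by (intro similar_mat_witI[of _ _ n]) auto
  then show ?thesis
    using assms by (auto simp: similar_pair_def)
qed

lemma two_block_column:
  assumes "v \<in> carrier_mat (Suc n) 1"
  obtains a c where "a \<in> carrier_mat 1 1" "c \<in> carrier_mat n 1"
    "v = four_block_mat a (0\<^sub>m 1 0) c (0\<^sub>m n 0)"
proof
  show "v = four_block_mat (mat 1 1 (\<lambda>_. v $$ (0, 0))) (0\<^sub>m 1 0)
    (mat n 1 (\<lambda>(i, _). v $$ (Suc i, 0))) (0\<^sub>m n 0)"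
    using assms by (intro eq_matI) auto
qed simp_all

lemma move_to_first_unit_of_pivot:
  fixes A :: "'a :: field mat"
  assumes A: "A \<in> carrier_mat (Suc n) (Suc n)" and a: "a \<noteq> 0" and c: "c \<in> carrier_mat n 1"
  shows "\<exists>B. similar_pair (Suc n) A (four_block_mat (a \<cdot>\<^sub>m 1\<^sub>m 1) (0\<^sub>m 1 0) c (0\<^sub>m n 0)) B (first_unit (Suc n))"
proof -
  let ?v = "four_block_mat (a \<cdot>\<^sub>m 1\<^sub>m 1) (0\<^sub>m 1 0) c (0\<^sub>m n 0)"
  define b where "b = inverse a"
  have ab: "a * b = 1" "b * a = 1" using a by (simp_all add: b_def)
  define P where "P = four_block_mat (a \<cdot>\<^sub>m 1\<^sub>m 1) (0\<^sub>m 1 n) c (1\<^sub>m n)"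
  define Q where "Q = four_block_mat (b \<cdot>\<^sub>m 1\<^sub>m 1) (0\<^sub>m 1 n) (- b \<cdot>\<^sub>m c) (1\<^sub>m n)"
  have s: "a \<cdot>\<^sub>m 1\<^sub>m 1 \<in> carrier_mat 1 1" "b \<cdot>\<^sub>m 1\<^sub>m 1 \<in> carrier_mat 1 1"
    "0\<^sub>m 1 n \<in> carrier_mat 1 n" "- b \<cdot>\<^sub>m c \<in> carrier_mat n 1" "1\<^sub>m n \<in> carrier_mat n n"
    "0\<^sub>m 1 0 \<in> carrier_mat 1 0" "0\<^sub>m n 0 \<in> carrier_mat n 0"
    using c by auto
  have "P * Q = 1\<^sub>m (1 + n)"
    unfolding P_def Q_def mult_four_block_mat[OF s(1,3) c s(5) s(2,3,4,5)] four_block_one_mat[symmetric]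
    using c ab by (intro cong_four_block_mat; intro eq_matI) (auto simp: scalar_prod_def)
  moreover have "Q * P = 1\<^sub>m (1 + n)"
    unfolding P_def Q_def mult_four_block_mat[OF s(2,3,4,5) s(1,3) c s(5)] four_block_one_mat[symmetric]
    using c ab by (intro cong_four_block_mat; intro eq_matI) (auto simp: scalar_prod_def algebra_simps)
  moreover have "Q * ?v = first_unit (Suc n)"
    unfolding Q_def first_unit_Suc mult_four_block_mat[OF s(2,3,4,5) s(1,6) c s(7)]
    using c ab by (intro cong_four_block_mat; intro eq_matI) (auto simp: scalar_prod_def algebra_simps)
  moreover have "P \<in> carrier_mat (1 + n) (1 + n)" "Q \<in> carrier_mat (1 + n) (1 + n)"
    unfolding P_def Q_def using s by (blast intro: four_block_carrier_mat)+
  moreover have "?v \<in> carrier_mat (1 + n) (1 + 0)"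
    using s(1,7) by (rule four_block_carrier_mat)
  ultimately show ?thesis
    using similar_pair_by[OF A] by (metis plus_1_eq_Suc add_0_right)
qed

text \<open>If the first entry of \<open>v\<close> vanishes, a shear makes it \<open>1\<close>; a vector with nonzero first
  entry can be taken as the first vector of a basis whose other vectors are standard ones.\<close>

lemma move_to_first_unit:
  fixes A v :: "'a :: field mat"
  assumes A: "A \<in> carrier_mat n n" and v: "v \<in> carrier_mat n 1" "v \<noteq> 0\<^sub>m n 1"
  shows "\<exists>B. similar_pair n A v B (first_unit n)"
proof (cases n)
  case 0
  then have "v = 0\<^sub>m n 1" using v(1) by (intro eq_matI) auto
  with v(2) show ?thesis by simp
next
  case (Suc m)
  obtain a c where a: "a \<in> carrier_mat 1 1" and c: "c \<in> carrier_mat m 1"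
    and v_eq: "v = four_block_mat a (0\<^sub>m 1 0) c (0\<^sub>m m 0)"
    using two_block_column v(1) Suc by metis
  have a_eq: "a = a $$ (0, 0) \<cdot>\<^sub>m 1\<^sub>m 1"
    using a by (intro eq_matI) auto
  show ?thesis
  proof (cases "a $$ (0, 0) = 0")
    case False
    then show ?thesis
      using move_to_first_unit_of_pivot[OF _ False c, of A] A a_eq Suc v_eq by simp
  next
    case True
    have a0: "a = 0\<^sub>m 1 1" using a True by (intro eq_matI) auto
    have "c \<noteq> 0\<^sub>m m 1"
    proof
      assume "c = 0\<^sub>m m 1"
      then have "v = 0\<^sub>m n 1" unfolding v_eq a0 Suc by (intro eq_matI) auto
      with v(2) show False by simp
    qed
    then obtain y where y: "y \<in> carrier_mat 1 m" "y * c = 1\<^sub>m 1"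
      using row_with_prescribed_product[OF c] by (metis one_carrier_mat)
    define P where "P = four_block_mat (1\<^sub>m 1) (- y) (0\<^sub>m m 1) (1\<^sub>m m)"
    define Q where "Q = four_block_mat (1\<^sub>m 1) y (0\<^sub>m m 1) (1\<^sub>m m)"
    have s: "1\<^sub>m 1 \<in> carrier_mat 1 1" "- y \<in> carrier_mat 1 m" "0\<^sub>m m 1 \<in> carrier_mat m 1" "1\<^sub>m m \<in> carrier_mat m m"
      "0\<^sub>m 1 0 \<in> carrier_mat 1 0" "0\<^sub>m m 0 \<in> carrier_mat m 0"
      using y by auto
    have "P * Q = 1\<^sub>m (1 + m)"
      unfolding P_def Q_def mult_four_block_mat[OF s(1-4) s(1) y(1) s(3,4)] four_block_one_mat[symmetric]
      using y by (intro cong_four_block_mat; intro eq_matI) auto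
    moreover have "Q * P = 1\<^sub>m (1 + m)"
      unfolding P_def Q_def mult_four_block_mat[OF s(1) y(1) s(3,4) s(1-4)] four_block_one_mat[symmetric]
      using y by (intro cong_four_block_mat; intro eq_matI) auto
    moreover have Qv: "Q * v = four_block_mat (1 \<cdot>\<^sub>m 1\<^sub>m 1) (0\<^sub>m 1 0) c (0\<^sub>m m 0)"
      unfolding Q_def v_eq mult_four_block_mat[OF s(1) y(1) s(3,4) a s(5) c s(6)]
      using y c a0 by (intro cong_four_block_mat) auto
    moreover have "P \<in> carrier_mat (1 + m) (1 + m)" "Q \<in> carrier_mat (1 + m) (1 + m)"
      unfolding P_def Q_def using s y by (blast intro: four_block_carrier_mat)+
    ultimately have pair: "similar_pair n A v (Q * A * P) (four_block_mat (1 \<cdot>\<^sub>m 1\<^sub>m 1) (0\<^sub>m 1 0) c (0\<^sub>m m 0))"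
      using A v(1) Suc by (intro similar_pair_by) auto
    have "Q * A * P \<in> carrier_mat (Suc m) (Suc m)"
      using \<open>P \<in> _\<close> \<open>Q \<in> _\<close> A Suc by auto
    from move_to_first_unit_of_pivot[OF this one_neq_zero c] pair show ?thesis
      unfolding Suc using similar_pair_trans by metis
  qed
qed

lemma similar_pair_lower_block:
  fixes a r c D :: "'a :: field mat"
  assumes a: "a \<in> carrier_mat 1 1" and r: "r \<in> carrier_mat 1 n" and c: "c \<in> carrier_mat n 1"
    and Dc: "D \<in> carrier_mat n n" and w: "similar_mat_wit D D' P Q"
  shows "similar_pair (Suc n) (four_block_mat a r c D) (first_unit (Suc n))
    (four_block_mat a (r * P) (Q * c) D') (first_unit (Suc n))"
proof -
  note PQ = similar_mat_witD2[OF Dc w]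
  have r_eq: "r = 1\<^sub>m 1 * (r * P) * Q"
    using r PQ by (simp add: mult_assoc_dim)
  have "P * (Q * c) = c"
    using left_inverse_mult_cancel[OF PQ(1,7,6) c] .
  have c_eq: "c = P * (Q * c) * 1\<^sub>m 1"
    using \<open>P * (Q * c) = c\<close> c by simp
  have rP: "r * P \<in> carrier_mat 1 n" and Qc: "Q * c \<in> carrier_mat n 1"
    using r c PQ by auto
  let ?S = "four_block_mat (1\<^sub>m 1) (0\<^sub>m 1 n) (0\<^sub>m n 1) P"
  let ?T = "four_block_mat (1\<^sub>m 1) (0\<^sub>m 1 n) (0\<^sub>m n 1) Q"
  have "similar_mat_wit (four_block_mat a r c D) (four_block_mat a (r * P) (Q * c) D') ?S ?T"
    by (rule similar_mat_wit_four_block[OF similar_mat_wit_refl[OF a] w r_eq c_eq a Dc Qc rP])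
  moreover have "?T * first_unit (Suc n) = first_unit (Suc n)"
    unfolding first_unit_Suc
      mult_four_block_mat[OF one_carrier_mat zero_carrier_mat zero_carrier_mat PQ(7)
        one_carrier_mat zero_carrier_mat zero_carrier_mat zero_carrier_mat]
    using PQ(7) by (intro cong_four_block_mat) simp_all
  moreover have "four_block_mat a r c D \<in> carrier_mat (1 + n) (1 + n)"
    using a Dc by (rule four_block_carrier_mat)
  ultimately show ?thesis
    by (auto simp: similar_pair_def)
qed

lemma two_coloured_extend:
  fixes a r c D :: "'a :: field mat"
  assumes a: "a \<in> carrier_mat 1 1" and D: "D \<in> carrier_mat n n" "two_coloured n s D"
    and c: "\<And>i. i < n \<Longrightarrow> s i = b \<Longrightarrow> c $$ (i, 0) = 0" and b: "b \<Longrightarrow> a $$ (0, 0) = 0"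
  shows "two_coloured (Suc n) (case_nat b s) (four_block_mat a r c D)"
  unfolding two_coloured_def
proof (intro allI impI)
  fix i j
  assume ij: "i < Suc n" "j \<le> i" "case_nat b s i = case_nat b s j" "j < i \<or> case_nat b s i"
  show "four_block_mat a r c D $$ (i, j) = 0"
  proof (cases i)
    case 0
    then show ?thesis using ij a D(1) b by simp
  next
    case i: (Suc i')
    show ?thesis
    proof (cases j)
      case 0
      then show ?thesis using ij i a D(1) c[of i'] by simp
    next
      case (Suc j')
      then show ?thesis
        using ij i a D(1) D(2)[unfolded two_coloured_def, rule_format, of i' j'] by auto
    qed
  qed
qed

text \<open>In terms of bases: if \<open>A v\<close> is no multiple of \<open>v\<close>, then \<open>A v\<close> may itself represent its
  class modulo \<open>v\<close>, and with this choice \<open>A v\<close> has no \<open>v\<close>-component.\<close>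

lemma shear_away_corner:
  fixes a r c D y :: "'a :: field mat"
  assumes a: "a \<in> carrier_mat 1 1" and r: "r \<in> carrier_mat 1 n" and c: "c \<in> carrier_mat n 1"
    and D: "D \<in> carrier_mat n n" and y: "y \<in> carrier_mat 1 n" "y * c = a"
  shows "\<exists>r' D'. r' \<in> carrier_mat 1 n \<and> D' \<in> carrier_mat n n \<and>
    similar_pair (Suc n) (four_block_mat a r c D) (first_unit (Suc n))
      (four_block_mat (0\<^sub>m 1 1) r' c D') (first_unit (Suc n))"
proof -
  have neg_y: "- y \<in> carrier_mat 1 n" using y by simp
  have "four_block_mat (1\<^sub>m 1) (- y) (0\<^sub>m n 1) (1\<^sub>m n) * first_unit (Suc n) = first_unit (Suc n)"
    unfolding first_unit_Suc
      mult_four_block_mat[OF one_carrier_mat neg_y zero_carrier_mat one_carrier_mat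
        one_carrier_mat zero_carrier_mat zero_carrier_mat zero_carrier_mat]
    using y by (intro cong_four_block_mat; intro eq_matI) auto
  moreover have "four_block_mat a r c D \<in> carrier_mat (1 + n) (1 + n)"
    using a D by (rule four_block_carrier_mat)
  moreover have "a - y * c = 0\<^sub>m 1 1" using y a by simp
  ultimately have "similar_pair (Suc n) (four_block_mat a r c D) (first_unit (Suc n))
    (four_block_mat (0\<^sub>m 1 1) (0\<^sub>m 1 1 * y + (r - y * D)) c (c * y + D)) (first_unit (Suc n))"
    using similar_shear_upper[OF a r c D y(1)] unfolding similar_pair_def by auto
  moreover have "0\<^sub>m 1 1 * y + (r - y * D) \<in> carrier_mat 1 n" "c * y + D \<in> carrier_mat n n"
    using r c D y(1) by auto
  ultimately show ?thesis by blast
qed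

text \<open>Induction on the dimension, splitting off the prescribed vector \<open>v\<close> as the first basis
  vector. If \<open>v\<close> is an eigenvector, the column below the corner vanishes, so \<open>v\<close> may get colour
  \<open>False\<close>, which allows a nonzero diagonal entry. Otherwise the induction hypothesis is used with the
  class of \<open>A v\<close> as the prescribed vector of the quotient: then \<open>A v\<close> is the second basis vector, the
  first column has a single nonzero entry, in the second row, and giving \<open>v\<close> the colour opposite
  to that of \<open>A v\<close> makes this entry harmless. That colour may be \<open>True\<close>, so
  the corner has to be cleared. Prescribing the first basis vector is what makes this
  induction go through.\<close>

lemma two_coloured_form:
  fixes A v :: "'a :: field mat"
  assumes "A \<in> carrier_mat n n" "v \<in> carrier_mat n 1" "v \<noteq> 0\<^sub>m n 1"
  shows "\<exists>B s. similar_pair n A v B (first_unit n) \<and> two_coloured n s B"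
  using assms
proof (induction n arbitrary: A v)
  case 0
  then have "v = 0\<^sub>m 0 1" by (intro eq_matI) auto
  with 0 show ?case by simp
next
  case (Suc n)
  obtain A1 where A1: "similar_pair (Suc n) A v A1 (first_unit (Suc n))"
    using move_to_first_unit Suc.prems by blast
  then have "A1 \<in> carrier_mat (Suc n) (Suc n)"
    using Suc.prems(1) by (auto simp: similar_pair_def dest: similar_mat_witD2)
  then have dims: "dim_row A1 = 1 + n" "dim_col A1 = 1 + n" by auto
  obtain a r c D where split: "split_block A1 1 1 = (a, r, c, D)"
    by (metis prod_cases4)
  note blocks = split_block[OF split dims]
  show ?case
  proof (cases "c = 0\<^sub>m n 1")
    case c0: True
    show ?thesis
    proof (cases "n = 0")
      case True
      then have "two_coloured (Suc n) (\<lambda>_. False) A1"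
        by (simp add: two_coloured_def)
      with A1 show ?thesis by blast
    next
      case False
      \<comment> \<open>The column below the corner is zero, so any nonzero vector of the quotient may come first.\<close>
      have "first_unit n \<noteq> (0\<^sub>m n 1 :: 'a mat)"
        using False by (intro first_unit_nonzero) simp
      from Suc.IH[OF blocks(4) first_unit_carrier(1) this]
      obtain D' s P Q where w: "similar_mat_wit D D' P Q" and s: "two_coloured n s D'"
        by (auto simp: similar_pair_def)
      note PQ = similar_mat_witD2[OF blocks(4) w]
      have "Q * c = 0\<^sub>m n 1" using PQ(7) c0 by simp
      then have "two_coloured (Suc n) (case_nat False s) (four_block_mat a (r * P) (Q * c) D')"
        by (intro two_coloured_extend blocks(1) PQ(5) s) simp_all
      with similar_pair_trans[OF A1[unfolded blocks(5)] similar_pair_lower_block[OF blocks(1-4) w]]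
      show ?thesis by blast
    qed
  next
    case False
    obtain y where y: "y \<in> carrier_mat 1 n" "y * c = a"
      using row_with_prescribed_product[OF blocks(3) False blocks(1)] by blast
    obtain r' E where r': "r' \<in> carrier_mat 1 n" and E: "E \<in> carrier_mat n n"
      and shear: "similar_pair (Suc n) A1 (first_unit (Suc n))
        (four_block_mat (0\<^sub>m 1 1) r' c E) (first_unit (Suc n))"
      using shear_away_corner[OF blocks(1-4) y] unfolding blocks(5) by blast
    obtain D' s P Q where w: "similar_mat_wit E D' P Q" "Q * c = first_unit n" and s: "two_coloured n s D'"
      using Suc.IH[OF E blocks(3) False] by (auto simp: similar_pair_def)
    have "two_coloured (Suc n) (case_nat (\<not> s 0) s) (four_block_mat (0\<^sub>m 1 1) (r' * P) (Q * c) D')"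
    proof (intro two_coloured_extend s)
      show "D' \<in> carrier_mat n n" using similar_mat_witD2[OF E w(1)] by simp
      show "(Q * c) $$ (i, 0) = 0" if "i < n" "s i = (\<not> s 0)" for i
        using that unfolding w(2) by (cases "i = 0") (simp_all add: first_unit_def)
    qed simp_all
    with similar_pair_trans[OF similar_pair_trans[OF A1 shear]
        similar_pair_lower_block[OF zero_carrier_mat r' blocks(3) E w(1)]]
    show ?thesis by blast
  qed
qed

section \<open>Trace-zero matrices\<close>

lemma mat_trace_mult_commute:
  fixes A B :: "'a :: comm_semiring_0 mat"
  assumes A: "A \<in> carrier_mat n m" and B: "B \<in> carrier_mat m n"
  shows "mat_trace (A * B) = mat_trace (B * A)"
proof -
  have "mat_trace (A * B) = (\<Sum>i<n. \<Sum>j<m. A $$ (i, j) * B $$ (j, i))"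
    using A B by (simp add: mat_trace_def scalar_prod_def lessThan_atLeast0)
  also have "\<dots> = (\<Sum>j<m. \<Sum>i<n. A $$ (i, j) * B $$ (j, i))"
    by (rule sum.swap)
  also have "\<dots> = mat_trace (B * A)"
    using A B by (simp add: mat_trace_def scalar_prod_def lessThan_atLeast0 mult.commute)
  finally show ?thesis .
qed

lemma is_commutator_similar:
  fixes A B :: "'a :: field mat"
  assumes A: "A \<in> carrier_mat n n" and w: "similar_mat_wit A B P Q" and B: "is_commutator n B"
  shows "is_commutator n A"
proof -
  note PQ = similar_mat_witD2[OF A w]
  obtain X Y where X: "X \<in> carrier_mat n n" and Y: "Y \<in> carrier_mat n n" and eq: "B = X * Y - Y * X"
    using B by (auto simp: is_commutator_def)
  have cancel: "Q * (P * M) = M" if "M \<in> carrier_mat n m" for M m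
    using left_inverse_mult_cancel[OF PQ(2,6,7) that] .
  have "A = P * X * Q * (P * Y * Q) - P * Y * Q * (P * X * Q)"
    unfolding PQ(3) eq using X Y PQ(6,7)
    by (simp add: distrib_left_dim distrib_right_dim mult_assoc_dim cancel[of _ n])
  moreover have "P * X * Q \<in> carrier_mat n n" "P * Y * Q \<in> carrier_mat n n"
    using X Y PQ(6,7) by simp_all
  ultimately show ?thesis
    unfolding is_commutator_def by blast
qed

text \<open>The theorem of Albert and Muckenhoupt, over an arbitrary field. Only the diagonal entries of
  colour \<open>False\<close> of a two-coloured form can be nonzero, so they sum to the trace.\<close>

lemma trace_zero_is_commutator:
  fixes A :: "'a :: field mat"
  assumes A: "A \<in> carrier_mat n n" and trace: "mat_trace A = 0"
  shows "is_commutator n A"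
proof (cases "n = 0")
  case True
  then show ?thesis
    using A by (intro is_commutator_two_coloured[where s = "\<lambda>_. False"]) (simp_all add: two_coloured_def)
next
  case False
  have "first_unit n \<noteq> (0\<^sub>m n 1 :: 'a mat)"
    using False by (intro first_unit_nonzero) simp
  from two_coloured_form[OF A first_unit_carrier(1) this]
  obtain B s P Q where w: "similar_mat_wit A B P Q" and s: "two_coloured n s B"
    by (auto simp: similar_pair_def)
  note PQ = similar_mat_witD2[OF A w]
  have "mat_trace A = mat_trace (Q * (P * B))"
    unfolding PQ(3) using PQ by (intro mat_trace_mult_commute[of _ n n]) auto
  also have "Q * (P * B) = B"
    using left_inverse_mult_cancel[OF PQ(2,6,7,5)] .
  finally have "(\<Sum>i<n. B $$ (i, i)) = 0"
    using trace PQ(5) by (simp add: mat_trace_def)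
  then show ?thesis
    using is_commutator_similar[OF A w] is_commutator_two_coloured[OF PQ(5) s] by blast
qed

theorem theorem1p2:
  fixes A :: "'a :: field mat" and n :: nat
  assumes "n > 0"
    and "A \<in> carrier_mat n n"
    and "mat_trace A = 0"
  shows "\<exists>S\<^sub>1 \<in> carrier_mat (2 * n) (2 * n). \<exists>S\<^sub>2 \<in> carrier_mat (2 * n) (2 * n). \<exists>S\<^sub>3 \<in> carrier_mat (2 * n) (2 * n).
    square_zero S\<^sub>1 \<and> square_zero S\<^sub>2 \<and> square_zero S\<^sub>3 \<and>
    direct_sum_zero A n = S\<^sub>1 + S\<^sub>2 + S\<^sub>3"
proof -
  obtain r P Q L R where PQ: "P \<in> carrier_mat n r" "Q \<in> carrier_mat r n" "L \<in> carrier_mat r n"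
    "R \<in> carrier_mat n r" and A: "A = P * Q" and inv: "L * P = 1\<^sub>m r" "Q * R = 1\<^sub>m r"
    using full_rank_factorization[OF assms(2)] by (elim exE conjE) (rule that)
  have trace: "mat_trace (Q * P) = 0"
    using assms(3) mat_trace_mult_commute[OF PQ(1,2)] unfolding A by (rule back_subst[of "\<lambda>x. x = 0"])
  have "Q * P \<in> carrier_mat r r" using PQ by simp
  then have "is_commutator r (Q * P)"
    using trace by (rule trace_zero_is_commutator)
  then obtain X Y where XY: "X \<in> carrier_mat r r" "Y \<in> carrier_mat r r" "Q * P = X * Y - Y * X"
    unfolding is_commutator_def by (elim bexE)
  show ?thesis
    using sum_of_three_square_zero_if_core_commutator[OF PQ inv XY]
    unfolding A sum_of_three_square_zero_def .
qed

end
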